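(* Let the atomic propositions of multi-agent epistemic logic $\mathsf{KB4}$ (with knowledge operators $K_a$, $a\in\mathcal A$) be the set $AP_e$ of environment atomic propositions of $\mathsf{2CH}$, and define the translation $t$ from $\mathsf{KB4}$-formulas to world formulas of $\mathsf{2CH}$ by $t(p)=p$, $t(\neg\Phi)=\neg t(\Phi)$, $t(\Phi\wedge\Psi)=t(\Phi)\wedge t(\Psi)$, $t(K_a\Phi)=[a]\Box_a t(\Phi)$. Then for every $\mathsf{KB4}$-formula $\Phi$: $\Phi$ is derivable in $\mathsf{KB4}+\mathsf{NE}$ if and only if $\vdash_e t(\Phi)$.
   Context: $\mathsf{KB4}+\mathsf{NE}$: the normal multimodal logic over a finite agent set $\mathcal A$ with operators $K_a$, axiomatized by all propositional tautologies, modus ponens, necessitation for each $K_a$, axiom $\mathsf K$: $K_a(\Phi\to\Psi)\to(K_a\Phi\to K_a\Psi)$, axiom $\mathsf B$: $\Phi\to K_a\neg K_a\neg\Phi$, axiom $\mathsf 4$: $K_a\Phi\to K_aK_a\Phi$, and axiom $\mathsf{NE}$: $\bigvee_{a\in\mathcal A}\neg K_a\bot$. Logic $\mathsf{2CH}$. Sets $AP_a$ ($a\in\mathcal A$) are arbitrary. Agent formulas of sort $a$: $\varphi ::= p_a \mid \neg\varphi \mid \varphi\wedge\psi \mid \Diamond_a\Phi$ ($p_a\in AP_a$, $\Phi$ a world formula). World formulas: $\Phi ::= p_e \mid \neg\Phi \mid \Phi\wedge\Psi \mid \langle a\rangle\varphi$ ($p_e\in AP_e$, $\varphi$ of sort $a$).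 $\Box_a\Phi:=\neg\Diamond_a\neg\Phi$, $[a]\varphi:=\neg\langle a\rangle\neg\varphi$, other connectives as usual abbreviations. Derivability $\vdash_a,\vdash_e$: least relations containing all propositional tautology instances at each sort, closed under modus ponens at each sort, and under: from $\vdash_e\Phi$ infer $\vdash_a\Box_a\Phi$; from $\vdash_a\varphi$ infer $\vdash_e[a]\varphi$; from $\vdash_e\Phi\to\Psi$ infer $\vdash_a\Diamond_a\Phi\to\Diamond_a\Psi$ and $\vdash_a\Box_a\Phi\to\Box_a\Psi$; from $\vdash_a\varphi\to\psi$ infer $\vdash_e\langle a\rangle\varphi\to\langle a\rangle\psi$ and $\vdash_e[a]\varphi\to[a]\psi$; $\vdash_e\Phi\to[a]\psi$ iff $\vdash_a\Diamond_a\Phi\to\psi$; $\vdash_a\varphi\to\Box_a\Psi$ iff $\vdash_e\langle a\rangle\varphi\to\Psi$; and with axioms $\vdash_a\varphi\to\Diamond_a\langle a\rangle\varphi$, $\vdash_a\Diamond_a\langle a\rangle\varphi\to\varphi$, $\vdash_e\bigvee_{a\in\mathcal A}\langle a\rangle\top$. *)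

theory Defs
  imports Main
begin

text \<open>
  The carriers \<open>A\<close> (agents), \<open>AP a\<close> (atoms of agent \<open>a\<close>) and \<open>APe\<close> (environment atoms) are sets,
  so raw syntax is cut down to the actual languages by well-formedness predicates.
  The grammars have no constants for truth and falsity. Falsity abbreviates \<open>\<chi> \<and> \<not>\<chi>\<close> and truth
  its negation; axioms mentioning them are schematic in \<open>\<chi>\<close>, and also in the enumeration
  of the finite set \<open>A\<close> along which a disjunction over all agents is written out. Such a disjunction
  ends in falsity, which makes the empty one falsity.
\<close>

section \<open>Epistemic logic KB4 + NE\<close>

datatype ('ag, 'pe) kform =
    KAtom 'pe
  | KNeg "('ag, 'pe) kform"
  | KAnd "('ag, 'pe) kform" "('ag, 'pe) kform"
  | Know 'ag "('ag, 'pe) kform"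

abbreviation KImp :: "('ag, 'pe) kform \<Rightarrow> ('ag, 'pe) kform \<Rightarrow> ('ag, 'pe) kform" where
  "KImp \<Phi> \<Psi> \<equiv> KNeg (KAnd \<Phi> (KNeg \<Psi>))"

abbreviation KOr :: "('ag, 'pe) kform \<Rightarrow> ('ag, 'pe) kform \<Rightarrow> ('ag, 'pe) kform" where
  "KOr \<Phi> \<Psi> \<equiv> KNeg (KAnd (KNeg \<Phi>) (KNeg \<Psi>))"

abbreviation KBot :: "('ag, 'pe) kform \<Rightarrow> ('ag, 'pe) kform" where
  "KBot \<chi> \<equiv> KAnd \<chi> (KNeg \<chi>)"

inductive kb4_formula :: "'ag set \<Rightarrow> 'pe set \<Rightarrow> ('ag, 'pe) kform \<Rightarrow> bool"
  for A :: "'ag set" and APe :: "'pe set" where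
  "p \<in> APe \<Longrightarrow> kb4_formula A APe (KAtom p)"
| "kb4_formula A APe \<Phi> \<Longrightarrow> kb4_formula A APe (KNeg \<Phi>)"
| "kb4_formula A APe \<Phi> \<Longrightarrow> kb4_formula A APe \<Psi> \<Longrightarrow> kb4_formula A APe (KAnd \<Phi> \<Psi>)"
| "a \<in> A \<Longrightarrow> kb4_formula A APe \<Phi> \<Longrightarrow> kb4_formula A APe (Know a \<Phi>)"

text \<open>
  An instance of a propositional tautology is a formula true under every truth assignment \<open>v\<close>
  to its propositionally indecomposable subformulas (atoms and modal formulas).
\<close>

fun keval :: "(('ag, 'pe) kform \<Rightarrow> bool) \<Rightarrow> ('ag, 'pe) kform \<Rightarrow> bool" where
  "keval v (KNeg \<Phi>) \<longleftrightarrow> \<not> keval v \<Phi>"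
| "keval v (KAnd \<Phi> \<Psi>) \<longleftrightarrow> keval v \<Phi> \<and> keval v \<Psi>"
| "keval v (KAtom p) \<longleftrightarrow> v (KAtom p)"
| "keval v (Know a \<Phi>) \<longleftrightarrow> v (Know a \<Phi>)"

definition ktautology :: "('ag, 'pe) kform \<Rightarrow> bool" where
  "ktautology \<Phi> \<longleftrightarrow> (\<forall>v. keval v \<Phi>)"

inductive KB4NE :: "'ag set \<Rightarrow> 'pe set \<Rightarrow> ('ag, 'pe) kform \<Rightarrow> bool"
  for A :: "'ag set" and APe :: "'pe set" where
  Taut: "kb4_formula A APe \<Phi> \<Longrightarrow> ktautology \<Phi> \<Longrightarrow> KB4NE A APe \<Phi>"
| MP: "KB4NE A APe (KImp \<Phi> \<Psi>) \<Longrightarrow> KB4NE A APe \<Phi> \<Longrightarrow> KB4NE A APe \<Psi>"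
| Nec: "a \<in> A \<Longrightarrow> KB4NE A APe \<Phi> \<Longrightarrow> KB4NE A APe (Know a \<Phi>)"
| AxK: "a \<in> A \<Longrightarrow> kb4_formula A APe \<Phi> \<Longrightarrow> kb4_formula A APe \<Psi> \<Longrightarrow>
    KB4NE A APe (KImp (Know a (KImp \<Phi> \<Psi>)) (KImp (Know a \<Phi>) (Know a \<Psi>)))"
| AxB: "a \<in> A \<Longrightarrow> kb4_formula A APe \<Phi> \<Longrightarrow>
    KB4NE A APe (KImp \<Phi> (Know a (KNeg (Know a (KNeg \<Phi>)))))"
| Ax4: "a \<in> A \<Longrightarrow> kb4_formula A APe \<Phi> \<Longrightarrow>
    KB4NE A APe (KImp (Know a \<Phi>) (Know a (Know a \<Phi>)))"
| AxNE: "distinct as \<Longrightarrow> set as = A \<Longrightarrow> kb4_formula A APe \<chi> \<Longrightarrow>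
    KB4NE A APe (foldr KOr (map (\<lambda>a. KNeg (Know a (KBot \<chi>))) as) (KBot \<chi>))"

section \<open>The two-sorted logic 2CH\<close>

text \<open>
  Agent atoms carry their sort, so the sets \<open>AP a\<close> for different \<open>a\<close> need not be assumed disjoint.
  \<open>Dia a\<close> is $\Diamond_a$ (world to agent formulas), \<open>Poss a\<close> is $\langle a\rangle$
  (agent to world formulas).
\<close>

datatype ('ag, 'pa, 'pe) aform =
    AAtom 'ag 'pa
  | ANeg "('ag, 'pa, 'pe) aform"
  | AAnd "('ag, 'pa, 'pe) aform" "('ag, 'pa, 'pe) aform"
  | Dia 'ag "('ag, 'pa, 'pe) wform"
and ('ag, 'pa, 'pe) wform =
    WAtom 'pe
  | WNeg "('ag, 'pa, 'pe) wform"
  | WAnd "('ag, 'pa, 'pe) wform" "('ag, 'pa, 'pe) wform"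
  | Poss 'ag "('ag, 'pa, 'pe) aform"

abbreviation AImp :: "('ag, 'pa, 'pe) aform \<Rightarrow> ('ag, 'pa, 'pe) aform \<Rightarrow> ('ag, 'pa, 'pe) aform" where
  "AImp \<phi> \<psi> \<equiv> ANeg (AAnd \<phi> (ANeg \<psi>))"

abbreviation ATop :: "('ag, 'pa, 'pe) aform \<Rightarrow> ('ag, 'pa, 'pe) aform" where
  "ATop \<chi> \<equiv> ANeg (AAnd \<chi> (ANeg \<chi>))"

abbreviation WImp :: "('ag, 'pa, 'pe) wform \<Rightarrow> ('ag, 'pa, 'pe) wform \<Rightarrow> ('ag, 'pa, 'pe) wform" where
  "WImp \<Phi> \<Psi> \<equiv> WNeg (WAnd \<Phi> (WNeg \<Psi>))"

abbreviation WOr :: "('ag, 'pa, 'pe) wform \<Rightarrow> ('ag, 'pa, 'pe) wform \<Rightarrow> ('ag, 'pa, 'pe) wform" where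
  "WOr \<Phi> \<Psi> \<equiv> WNeg (WAnd (WNeg \<Phi>) (WNeg \<Psi>))"

abbreviation WBot :: "('ag, 'pa, 'pe) wform \<Rightarrow> ('ag, 'pa, 'pe) wform" where
  "WBot \<chi> \<equiv> WAnd \<chi> (WNeg \<chi>)"

abbreviation Box :: "'ag \<Rightarrow> ('ag, 'pa, 'pe) wform \<Rightarrow> ('ag, 'pa, 'pe) aform" where
  "Box a \<Phi> \<equiv> ANeg (Dia a (WNeg \<Phi>))"

abbreviation Cert :: "'ag \<Rightarrow> ('ag, 'pa, 'pe) aform \<Rightarrow> ('ag, 'pa, 'pe) wform" where
  "Cert a \<phi> \<equiv> WNeg (Poss a (ANeg \<phi>))"

inductive agent_formula ::
    "'ag set \<Rightarrow> ('ag \<Rightarrow> 'pa set) \<Rightarrow> 'pe set \<Rightarrow> 'ag \<Rightarrow> ('ag, 'pa, 'pe) aform \<Rightarrow> bool"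
  and world_formula ::
    "'ag set \<Rightarrow> ('ag \<Rightarrow> 'pa set) \<Rightarrow> 'pe set \<Rightarrow> ('ag, 'pa, 'pe) wform \<Rightarrow> bool"
  for A :: "'ag set" and AP :: "'ag \<Rightarrow> 'pa set" and APe :: "'pe set" where
  "a \<in> A \<Longrightarrow> p \<in> AP a \<Longrightarrow> agent_formula A AP APe a (AAtom a p)"
| "agent_formula A AP APe a \<phi> \<Longrightarrow> agent_formula A AP APe a (ANeg \<phi>)"
| "agent_formula A AP APe a \<phi> \<Longrightarrow> agent_formula A AP APe a \<psi> \<Longrightarrow>
    agent_formula A AP APe a (AAnd \<phi> \<psi>)"
| "a \<in> A \<Longrightarrow> world_formula A AP APe \<Phi> \<Longrightarrow> agent_formula A AP APe a (Dia a \<Phi>)"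
| "p \<in> APe \<Longrightarrow> world_formula A AP APe (WAtom p)"
| "world_formula A AP APe \<Phi> \<Longrightarrow> world_formula A AP APe (WNeg \<Phi>)"
| "world_formula A AP APe \<Phi> \<Longrightarrow> world_formula A AP APe \<Psi> \<Longrightarrow>
    world_formula A AP APe (WAnd \<Phi> \<Psi>)"
| "a \<in> A \<Longrightarrow> agent_formula A AP APe a \<phi> \<Longrightarrow> world_formula A AP APe (Poss a \<phi>)"

fun aeval :: "(('ag, 'pa, 'pe) aform \<Rightarrow> bool) \<Rightarrow> ('ag, 'pa, 'pe) aform \<Rightarrow> bool" where
  "aeval v (ANeg \<phi>) \<longleftrightarrow> \<not> aeval v \<phi>"
| "aeval v (AAnd \<phi> \<psi>) \<longleftrightarrow> aeval v \<phi> \<and> aeval v \<psi>"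
| "aeval v (AAtom a p) \<longleftrightarrow> v (AAtom a p)"
| "aeval v (Dia a \<Phi>) \<longleftrightarrow> v (Dia a \<Phi>)"

fun weval :: "(('ag, 'pa, 'pe) wform \<Rightarrow> bool) \<Rightarrow> ('ag, 'pa, 'pe) wform \<Rightarrow> bool" where
  "weval v (WNeg \<Phi>) \<longleftrightarrow> \<not> weval v \<Phi>"
| "weval v (WAnd \<Phi> \<Psi>) \<longleftrightarrow> weval v \<Phi> \<and> weval v \<Psi>"
| "weval v (WAtom p) \<longleftrightarrow> v (WAtom p)"
| "weval v (Poss a \<phi>) \<longleftrightarrow> v (Poss a \<phi>)"

definition atautology :: "('ag, 'pa, 'pe) aform \<Rightarrow> bool" where
  "atautology \<phi> \<longleftrightarrow> (\<forall>v. aeval v \<phi>)"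

definition wtautology :: "('ag, 'pa, 'pe) wform \<Rightarrow> bool" where
  "wtautology \<Phi> \<longleftrightarrow> (\<forall>v. weval v \<Phi>)"

text \<open>
  \<open>agent_derivable A AP APe a\<close> is $\vdash_a$ and \<open>world_derivable A AP APe\<close> is $\vdash_e$. Rules
  without well-formedness premises inherit it from their derivable premises.
\<close>

inductive agent_derivable ::
    "'ag set \<Rightarrow> ('ag \<Rightarrow> 'pa set) \<Rightarrow> 'pe set \<Rightarrow> 'ag \<Rightarrow> ('ag, 'pa, 'pe) aform \<Rightarrow> bool"
  and world_derivable ::
    "'ag set \<Rightarrow> ('ag \<Rightarrow> 'pa set) \<Rightarrow> 'pe set \<Rightarrow> ('ag, 'pa, 'pe) wform \<Rightarrow> bool"
  for A :: "'ag set" and AP :: "'ag \<Rightarrow> 'pa set" and APe :: "'pe set" where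
  ATaut: "agent_formula A AP APe a \<phi> \<Longrightarrow> atautology \<phi> \<Longrightarrow> agent_derivable A AP APe a \<phi>"
| WTaut: "world_formula A AP APe \<Phi> \<Longrightarrow> wtautology \<Phi> \<Longrightarrow> world_derivable A AP APe \<Phi>"
| AMP: "agent_derivable A AP APe a (AImp \<phi> \<psi>) \<Longrightarrow> agent_derivable A AP APe a \<phi> \<Longrightarrow>
    agent_derivable A AP APe a \<psi>"
| WMP: "world_derivable A AP APe (WImp \<Phi> \<Psi>) \<Longrightarrow> world_derivable A AP APe \<Phi> \<Longrightarrow>
    world_derivable A AP APe \<Psi>"
| NecBox: "a \<in> A \<Longrightarrow> world_derivable A AP APe \<Phi> \<Longrightarrow> agent_derivable A AP APe a (Box a \<Phi>)"
| NecCert: "a \<in> A \<Longrightarrow> agent_derivable A AP APe a \<phi> \<Longrightarrow> world_derivable A AP APe (Cert a \<phi>)"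
| MonoDia: "a \<in> A \<Longrightarrow> world_derivable A AP APe (WImp \<Phi> \<Psi>) \<Longrightarrow>
    agent_derivable A AP APe a (AImp (Dia a \<Phi>) (Dia a \<Psi>))"
| MonoBox: "a \<in> A \<Longrightarrow> world_derivable A AP APe (WImp \<Phi> \<Psi>) \<Longrightarrow>
    agent_derivable A AP APe a (AImp (Box a \<Phi>) (Box a \<Psi>))"
| MonoPoss: "a \<in> A \<Longrightarrow> agent_derivable A AP APe a (AImp \<phi> \<psi>) \<Longrightarrow>
    world_derivable A AP APe (WImp (Poss a \<phi>) (Poss a \<psi>))"
| MonoCert: "a \<in> A \<Longrightarrow> agent_derivable A AP APe a (AImp \<phi> \<psi>) \<Longrightarrow>
    world_derivable A AP APe (WImp (Cert a \<phi>) (Cert a \<psi>))"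
| AdjDiaCert1: "a \<in> A \<Longrightarrow> world_derivable A AP APe (WImp \<Phi> (Cert a \<psi>)) \<Longrightarrow>
    agent_derivable A AP APe a (AImp (Dia a \<Phi>) \<psi>)"
| AdjDiaCert2: "a \<in> A \<Longrightarrow> agent_derivable A AP APe a (AImp (Dia a \<Phi>) \<psi>) \<Longrightarrow>
    world_derivable A AP APe (WImp \<Phi> (Cert a \<psi>))"
| AdjPossBox1: "a \<in> A \<Longrightarrow> agent_derivable A AP APe a (AImp \<phi> (Box a \<Psi>)) \<Longrightarrow>
    world_derivable A AP APe (WImp (Poss a \<phi>) \<Psi>)"
| AdjPossBox2: "a \<in> A \<Longrightarrow> world_derivable A AP APe (WImp (Poss a \<phi>) \<Psi>) \<Longrightarrow>
    agent_derivable A AP APe a (AImp \<phi> (Box a \<Psi>))"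
| AxDiaPoss1: "a \<in> A \<Longrightarrow> agent_formula A AP APe a \<phi> \<Longrightarrow>
    agent_derivable A AP APe a (AImp \<phi> (Dia a (Poss a \<phi>)))"
| AxDiaPoss2: "a \<in> A \<Longrightarrow> agent_formula A AP APe a \<phi> \<Longrightarrow>
    agent_derivable A AP APe a (AImp (Dia a (Poss a \<phi>)) \<phi>)"
| AxNE2: "distinct as \<Longrightarrow> set as = A \<Longrightarrow> (\<And>a. a \<in> A \<Longrightarrow> agent_formula A AP APe a (\<xi> a)) \<Longrightarrow>
    world_formula A AP APe \<chi> \<Longrightarrow>
    world_derivable A AP APe (foldr WOr (map (\<lambda>a. Poss a (ATop (\<xi> a))) as) (WBot \<chi>))"

section \<open>The translation\<close>

primrec kb4_to_2ch :: "('ag, 'pe) kform \<Rightarrow> ('ag, 'pa, 'pe) wform" where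
  "kb4_to_2ch (KAtom p) = WAtom p"
| "kb4_to_2ch (KNeg \<Phi>) = WNeg (kb4_to_2ch \<Phi>)"
| "kb4_to_2ch (KAnd \<Phi> \<Psi>) = WAnd (kb4_to_2ch \<Phi>) (kb4_to_2ch \<Psi>)"
| "kb4_to_2ch (Know a \<Phi>) = Cert a (Box a (kb4_to_2ch \<Phi>))"

end

theory Submission
  imports Defs
begin

text \<open>
  Both directions are proof-theoretic. Write \<open>M\<^sub>a\<close> for $[a]\Box_a$. The adjunctions make
  $\langle a\rangle\Diamond_a$ left adjoint to \<open>M\<^sub>a\<close>, and $\Diamond_a\langle a\rangle$ is the
  identity; K, B and 4 for \<open>M\<^sub>a\<close> are formal consequences.

  Conversely, 2CH is interpreted back into KB4 + NE. A world formula goes to a formula with the same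
  meaning, and an agent formula \<open>\<phi>\<close> of sort \<open>a\<close> goes to a formula expressing $\langle a\rangle\varphi$;
  so negation at sort \<open>a\<close> becomes negation relative to ``\<open>a\<close> is alive'', that is $\neg K_a\bot$.
  The formulas \<open>X\<close> in the image of sort \<open>a\<close> imply that \<open>a\<close> is alive, and they are local to \<open>a\<close>:
  $X \to K_a X$ and $\neg X \to K_a \neg X$. With these invariants every rule of 2CH is admissible
  in KB4 + NE, and the interpretation is a left inverse of the translation up to equivalence.
\<close>

inductive_simps kb4_formula_simps [simp]:
  "kb4_formula A APe (KAtom p)"
  "kb4_formula A APe (KNeg \<Phi>)"
  "kb4_formula A APe (KAnd \<Phi> \<Psi>)"
  "kb4_formula A APe (Know a \<Phi>)"

inductive_simps agent_formula_simps [simp]: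
  "agent_formula A AP APe a (AAtom b p)"
  "agent_formula A AP APe a (ANeg \<phi>)"
  "agent_formula A AP APe a (AAnd \<phi> \<psi>)"
  "agent_formula A AP APe a (Dia b \<Phi>)"

inductive_simps world_formula_simps [simp]:
  "world_formula A AP APe (WAtom p)"
  "world_formula A AP APe (WNeg \<Phi>)"
  "world_formula A AP APe (WAnd \<Phi> \<Psi>)"
  "world_formula A AP APe (Poss a \<phi>)"

section \<open>Propositional reasoning\<close>

lemma kb4_formula_foldr_KOr:
  "kb4_formula A APe (foldr KOr Xs Y) \<longleftrightarrow> (\<forall>X\<in>set Xs. kb4_formula A APe X) \<and> kb4_formula A APe Y"
  by (induction Xs) auto

lemma keval_foldr_KOr:
  "keval v (foldr KOr Xs Y) \<longleftrightarrow> (\<exists>X\<in>set Xs. keval v X) \<or> keval v Y"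
  by (induction Xs) auto

lemma world_formula_foldr_WOr:
  "world_formula A AP APe (foldr WOr Xs Y) \<longleftrightarrow>
    (\<forall>X\<in>set Xs. world_formula A AP APe X) \<and> world_formula A AP APe Y"
  by (induction Xs) auto

lemma KB4NE_formula: "KB4NE A APe \<Phi> \<Longrightarrow> kb4_formula A APe \<Phi>"
  by (induction rule: KB4NE.induct) (auto simp: kb4_formula_foldr_KOr)

lemma derivable_formula:
  "agent_derivable A AP APe a \<phi> \<Longrightarrow> agent_formula A AP APe a \<phi>"
  "world_derivable A AP APe \<Phi> \<Longrightarrow> world_formula A AP APe \<Phi>"
  by (induction rule: agent_derivable_world_derivable.inducts)
    (auto simp: world_formula_foldr_WOr)

text \<open>Propositional steps are checked semantically, over all valuations \<open>v\<close>,
  instead of by Hilbert derivations. In the variants below, each premise costs one modus ponens with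
  an implication that is itself a consequence of the remaining premises.\<close>

lemma KB4NE_conseq0:
  assumes "kb4_formula A APe Y" "\<And>v. keval v Y"
  shows "KB4NE A APe Y"
  using assms by (auto intro: KB4NE.Taut simp: ktautology_def)

lemma KB4NE_conseq1:
  assumes X: "KB4NE A APe X" and Y: "kb4_formula A APe Y" and "\<And>v. keval v X \<Longrightarrow> keval v Y"
  shows "KB4NE A APe Y"
proof (rule KB4NE.MP[OF _ X])
  show "KB4NE A APe (KImp X Y)"
    using assms KB4NE_formula[OF X] by (intro KB4NE_conseq0) auto
qed

lemma KB4NE_conseq2:
  assumes X: "KB4NE A APe X" and X': "KB4NE A APe X'" and Y: "kb4_formula A APe Y"
    and "\<And>v. keval v X \<Longrightarrow> keval v X' \<Longrightarrow> keval v Y"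
  shows "KB4NE A APe Y"
proof (rule KB4NE.MP[OF _ X])
  show "KB4NE A APe (KImp X Y)"
    using assms KB4NE_formula[OF X] by (intro KB4NE_conseq1[OF X']) auto
qed

lemma KB4NE_conseq3:
  assumes X: "KB4NE A APe X" and X': "KB4NE A APe X'" and X'': "KB4NE A APe X''"
    and Y: "kb4_formula A APe Y"
    and "\<And>v. keval v X \<Longrightarrow> keval v X' \<Longrightarrow> keval v X'' \<Longrightarrow> keval v Y"
  shows "KB4NE A APe Y"
proof (rule KB4NE.MP[OF _ X])
  show "KB4NE A APe (KImp X Y)"
    using assms KB4NE_formula[OF X] by (intro KB4NE_conseq2[OF X' X'']) auto
qed

lemma world_derivable_conseq0:
  assumes "world_formula A AP APe Y" "\<And>v. weval v Y"
  shows "world_derivable A AP APe Y"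
  using assms by (auto intro: WTaut simp: wtautology_def)

lemma world_derivable_conseq1:
  assumes X: "world_derivable A AP APe X" and Y: "world_formula A AP APe Y"
    and "\<And>v. weval v X \<Longrightarrow> weval v Y"
  shows "world_derivable A AP APe Y"
proof (rule WMP[OF _ X])
  show "world_derivable A AP APe (WImp X Y)"
    using assms derivable_formula(2)[OF X] by (intro world_derivable_conseq0) auto
qed

lemma world_derivable_conseq2:
  assumes X: "world_derivable A AP APe X" and X': "world_derivable A AP APe X'"
    and Y: "world_formula A AP APe Y"
    and "\<And>v. weval v X \<Longrightarrow> weval v X' \<Longrightarrow> weval v Y"
  shows "world_derivable A AP APe Y"
proof (rule WMP[OF _ X])
  show "world_derivable A AP APe (WImp X Y)"
    using assms derivable_formula(2)[OF X] by (intro world_derivable_conseq1[OF X']) auto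
qed

lemma agent_derivable_conseq0:
  assumes "agent_formula A AP APe a y" "\<And>v. aeval v y"
  shows "agent_derivable A AP APe a y"
  using assms by (auto intro: ATaut simp: atautology_def)

lemma agent_derivable_conseq1:
  assumes X: "agent_derivable A AP APe a x" and Y: "agent_formula A AP APe a y"
    and "\<And>v. aeval v x \<Longrightarrow> aeval v y"
  shows "agent_derivable A AP APe a y"
proof (rule AMP[OF _ X])
  show "agent_derivable A AP APe a (AImp x y)"
    using assms derivable_formula(1)[OF X] by (intro agent_derivable_conseq0) auto
qed

lemma agent_derivable_conseq2:
  assumes X: "agent_derivable A AP APe a x" and X': "agent_derivable A AP APe a x'"
    and Y: "agent_formula A AP APe a y"
    and "\<And>v. aeval v x \<Longrightarrow> aeval v x' \<Longrightarrow> aeval v y"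
  shows "agent_derivable A AP APe a y"
proof (rule AMP[OF _ X])
  show "agent_derivable A AP APe a (AImp x y)"
    using assms derivable_formula(1)[OF X] by (intro agent_derivable_conseq1[OF X']) auto
qed

section \<open>From KB4 + NE to 2CH\<close>

abbreviation CertBox :: "'ag \<Rightarrow> ('ag, 'pa, 'pe) wform \<Rightarrow> ('ag, 'pa, 'pe) wform" where
  "CertBox a \<Phi> \<equiv> Cert a (Box a \<Phi>)"

section \<open>The composite adjunction and the axioms K, B and 4\<close>

text \<open>\<open>Poss a\<close> is left adjoint to \<open>Box a\<close>, and \<open>Dia a\<close>
  to \<open>Cert a\<close>; both sides amount to \<open>AImp (Dia a X) (Box a Y)\<close> at sort
  \<open>a\<close>.\<close>

lemma PossDia_CertBox_adjunction:
  assumes "a \<in> A"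
  shows "world_derivable A AP APe (WImp (Poss a (Dia a X)) Y) \<longleftrightarrow>
    world_derivable A AP APe (WImp X (CertBox a Y))"
  using AdjDiaCert1 AdjDiaCert2 AdjPossBox1 AdjPossBox2 assms by meson

lemma CertBox_counit:
  assumes "a \<in> A" "world_formula A AP APe X"
  shows "world_derivable A AP APe (WImp (Poss a (Dia a (CertBox a X))) X)"
  unfolding PossDia_CertBox_adjunction[OF assms(1)]
  using assms by (intro world_derivable_conseq0) auto

text \<open>A right adjoint respects conjunction: both projections of \<open>?W\<close> are
  transposed, combined propositionally, and the result is transposed back.\<close>

lemma CertBox_K:
  assumes a: "a \<in> A" and X: "world_formula A AP APe X" and Y: "world_formula A AP APe Y"
  shows "world_derivable A AP APe
    (WImp (CertBox a (WImp X Y)) (WImp (CertBox a X) (CertBox a Y)))"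
proof -
  let ?W = "WAnd (CertBox a (WImp X Y)) (CertBox a X)"
  have "world_derivable A AP APe (WImp ?W (CertBox a (WImp X Y)))"
    "world_derivable A AP APe (WImp ?W (CertBox a X))"
    using assms by (auto intro!: world_derivable_conseq0)
  then have "world_derivable A AP APe (WImp (Poss a (Dia a ?W)) (WImp X Y))"
    "world_derivable A AP APe (WImp (Poss a (Dia a ?W)) X)"
    using PossDia_CertBox_adjunction[OF a] by blast+
  then have "world_derivable A AP APe (WImp (Poss a (Dia a ?W)) Y)"
    by (rule world_derivable_conseq2) (use assms in auto)
  then have "world_derivable A AP APe (WImp ?W (CertBox a Y))"
    using PossDia_CertBox_adjunction[OF a] by blast
  then show ?thesis
    by (rule world_derivable_conseq1) (use assms in auto)
qed

text \<open>The transposed claim says, up to double negations, that \<open>Poss a (Dia a X)\<close>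
  implies itself.\<close>

lemma CertBox_B:
  assumes a: "a \<in> A" and X: "world_formula A AP APe X"
  shows "world_derivable A AP APe (WImp X (CertBox a (WNeg (CertBox a (WNeg X)))))"
proof -
  have "world_derivable A AP APe (WImp X (WNeg (WNeg X)))"
    using X by (intro world_derivable_conseq0) auto
  from MonoDia[OF a this]
  have "agent_derivable A AP APe a (AImp (Dia a X) (ANeg (ANeg (Dia a (WNeg (WNeg X))))))"
    by (rule agent_derivable_conseq1) (use assms in auto)
  from MonoPoss[OF a this]
  have "world_derivable A AP APe (WImp (Poss a (Dia a X)) (WNeg (CertBox a (WNeg X))))"
    by (rule world_derivable_conseq1) (use assms in auto)
  then show ?thesis
    using PossDia_CertBox_adjunction[OF a] by blast
qed

text \<open>Transposing twice puts \<open>Poss a (Dia a (Poss a ?D))\<close> on the left and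
  \<open>X\<close> on the right. The inner \<open>Dia a (Poss a ?D)\<close> collapses to
  \<open>?D\<close>, and the counit remains.\<close>

lemma CertBox_4:
  assumes a: "a \<in> A" and X: "world_formula A AP APe X"
  shows "world_derivable A AP APe (WImp (CertBox a X) (CertBox a (CertBox a X)))"
proof -
  let ?D = "Dia a (CertBox a X)"
  have "agent_derivable A AP APe a (AImp (Dia a (Poss a ?D)) ?D)"
    using assms by (intro AxDiaPoss2) auto
  from MonoPoss[OF a this] CertBox_counit[OF assms]
  have "world_derivable A AP APe (WImp (Poss a (Dia a (Poss a ?D))) X)"
    by (rule world_derivable_conseq2) (use assms in auto)
  then show ?thesis
    using PossDia_CertBox_adjunction[OF a] by blast
qed

text \<open>Truth at sort \<open>a\<close> implies \<open>Dia a (Poss a (ATop \<xi>))\<close>;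
  weakening the world formula inside to truth gives the negation of \<open>Box a\<close> of
  falsity.\<close>

lemma Poss_ATop_imp_not_CertBox_WBot:
  assumes a: "a \<in> A" and X: "world_formula A AP APe X" and \<xi>: "agent_formula A AP APe a \<xi>"
  shows "world_derivable A AP APe (WImp (Poss a (ATop \<xi>)) (WNeg (CertBox a (WBot X))))"
proof -
  have "world_derivable A AP APe (WImp (Poss a (ATop \<xi>)) (WNeg (WBot X)))"
    using assms by (intro world_derivable_conseq0) auto
  from MonoDia[OF a this] AxDiaPoss1[OF a, of AP APe "ATop \<xi>"]
  have "agent_derivable A AP APe a (AImp (ATop \<xi>) (ANeg (ANeg (Dia a (WNeg (WBot X))))))"
    by (rule agent_derivable_conseq2) (use assms in auto)
  from MonoPoss[OF a this] show ?thesis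
    by (rule world_derivable_conseq1) (use assms in auto)
qed

lemma world_derivable_foldr_WOr_mono:
  assumes "world_derivable A AP APe (foldr WOr (map f xs) Z)"
    and "\<And>x. x \<in> set xs \<Longrightarrow> world_derivable A AP APe (WImp (f x) (g x))"
  shows "world_derivable A AP APe (foldr WOr (map g xs) Z)"
proof -
  have Z: "world_formula A AP APe Z"
    using derivable_formula(2)[OF assms(1)] by (auto simp: world_formula_foldr_WOr)
  have "world_derivable A AP APe (WImp (foldr WOr (map f xs) Z) (foldr WOr (map g xs) Z))"
    using assms(2)
  proof (induction xs)
    case Nil
    then show ?case using Z by (intro world_derivable_conseq0) auto
  next
    case (Cons x xs)
    have fg: "world_derivable A AP APe (WImp (f x) (g x))"
      by (simp add: Cons.prems)
    have IH: "world_derivable A AP APe (WImp (foldr WOr (map f xs) Z) (foldr WOr (map g xs) Z))"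
      by (intro Cons.IH Cons.prems) auto
    show ?case
      by (rule world_derivable_conseq2[OF fg IH])
        (use derivable_formula(2)[OF fg] derivable_formula(2)[OF IH] in auto)
  qed
  then show ?thesis
    using WMP assms(1) by blast
qed

section \<open>The translation preserves derivability\<close>

lemma world_formula_kb4_to_2ch:
  "kb4_formula A APe \<Phi> \<Longrightarrow> world_formula A AP APe (kb4_to_2ch \<Phi>)"
  by (induction \<Phi>) auto

text \<open>Valuations of world formulas pull back along the translation, so tautologies translate
  to tautologies.\<close>

lemma weval_kb4_to_2ch:
  "weval v (kb4_to_2ch \<Phi>) \<longleftrightarrow> keval (\<lambda>X. weval v (kb4_to_2ch X)) \<Phi>"
  by (induction \<Phi>) auto

lemma kb4_to_2ch_foldr_KOr:
  "kb4_to_2ch (foldr KOr Xs Y) = foldr WOr (map kb4_to_2ch Xs) (kb4_to_2ch Y)"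
  by (induction Xs) auto

lemma KB4NE_imp_world_derivable:
  "KB4NE A APe \<Phi> \<Longrightarrow> world_derivable A AP APe (kb4_to_2ch \<Phi>)"
proof (induction rule: KB4NE.induct)
  case (Taut \<Phi>)
  then show ?case
    by (intro world_derivable_conseq0 world_formula_kb4_to_2ch)
      (auto simp: ktautology_def, subst weval_kb4_to_2ch, simp)
next
  case (MP \<Phi> \<Psi>)
  then show ?case by (auto intro: WMP)
next
  case (Nec a \<Phi>)
  then show ?case by (auto intro: NecBox NecCert)
next
  case (AxK a \<Phi> \<Psi>)
  then show ?case by (simp add: CertBox_K world_formula_kb4_to_2ch)
next
  case (AxB a \<Phi>)
  then show ?case by (simp add: CertBox_B world_formula_kb4_to_2ch)
next
  case (Ax4 a \<Phi>)
  then show ?case by (simp add: CertBox_4 world_formula_kb4_to_2ch)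
next
  case (AxNE as \<chi>)
  let ?X = "kb4_to_2ch \<chi> :: ('a, 'c, 'b) wform"
  have X: "world_formula A AP APe ?X"
    using AxNE by (simp add: world_formula_kb4_to_2ch)
  \<comment> \<open>As \<open>AP a\<close> may be empty, the formula of sort \<open>a\<close> used
    to write truth is built from the world formula \<open>?X\<close>.\<close>
  have "world_derivable A AP APe (foldr WOr (map (\<lambda>a. Poss a (ATop (Dia a ?X))) as) (WBot ?X))"
    using AxNE X by (intro AxNE2) auto
  then have "world_derivable A AP APe
      (foldr WOr (map (\<lambda>a. WNeg (CertBox a (WBot ?X))) as) (WBot ?X))"
    by (rule world_derivable_foldr_WOr_mono)
      (use AxNE X in \<open>auto intro!: Poss_ATop_imp_not_CertBox_WBot\<close>)
  then show ?case
    by (simp add: kb4_to_2ch_foldr_KOr comp_def)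
qed

section \<open>Modal reasoning in KB4\<close>

lemma Know_mono:
  assumes a: "a \<in> A" and XY: "KB4NE A APe (KImp X Y)"
  shows "KB4NE A APe (KImp (Know a X) (Know a Y))"
  using KB4NE.MP[OF KB4NE.AxK KB4NE.Nec[OF a XY]] a KB4NE_formula[OF XY] by auto

lemma Know_mono2:
  assumes a: "a \<in> A" and XYZ: "KB4NE A APe (KImp X (KImp Y Z))"
  shows "KB4NE A APe (KImp (Know a X) (KImp (Know a Y) (Know a Z)))"
proof -
  have wf: "kb4_formula A APe X" "kb4_formula A APe Y" "kb4_formula A APe Z"
    using KB4NE_formula[OF XYZ] by auto
  show ?thesis
    by (rule KB4NE_conseq2[OF Know_mono[OF a XYZ] KB4NE.AxK[OF a wf(2,3)]]) (use a wf in auto)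
qed

text \<open>In a symmetric transitive frame this holds exactly at the worlds that are reflexive for
  \<open>a\<close>.\<close>

abbreviation Alive :: "('ag, 'pe) kform \<Rightarrow> 'ag \<Rightarrow> ('ag, 'pe) kform" where
  "Alive \<chi> a \<equiv> KNeg (Know a (KBot \<chi>))"

lemma not_Alive_imp_Know:
  assumes "a \<in> A" "kb4_formula A APe \<chi>" "kb4_formula A APe X"
  shows "KB4NE A APe (KImp (KNeg (Alive \<chi> a)) (Know a X))"
proof -
  have "KB4NE A APe (KImp (KBot \<chi>) X)"
    using assms by (intro KB4NE_conseq0) auto
  from Know_mono[OF assms(1) this] show ?thesis
    by (rule KB4NE_conseq1) (use assms in auto)
qed

text \<open>Axiom B for truth, with the double negation removed under \<open>Know a\<close>.\<close>

lemma Know_Alive: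
  assumes a: "a \<in> A" and \<chi>: "kb4_formula A APe \<chi>"
  shows "KB4NE A APe (Know a (Alive \<chi> a))"
proof -
  have "KB4NE A APe (KImp (KBot \<chi>) (KNeg (KNeg (KBot \<chi>))))"
    using \<chi> by (intro KB4NE_conseq0) auto
  from Know_mono[OF a this]
  have "KB4NE A APe (KImp (KNeg (Know a (KNeg (KNeg (KBot \<chi>))))) (Alive \<chi> a))"
    by (rule KB4NE_conseq1) (use assms in auto)
  from Know_mono[OF a this] KB4NE.AxB[OF a, of APe "KNeg (KBot \<chi>)"]
  show ?thesis
    by (rule KB4NE_conseq2) (use assms in auto)
qed

text \<open>Axiom 5 from B and 4: B is taken at \<open>KNeg (Know a X)\<close>, and the
  contrapositive of 4 simplifies what is then known.\<close>

lemma Know_negative_introspection: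
  assumes a: "a \<in> A" and X: "kb4_formula A APe X"
  shows "KB4NE A APe (KImp (KNeg (Know a X)) (Know a (KNeg (Know a X))))"
proof -
  have "KB4NE A APe (KImp (Know a X) (KNeg (KNeg (Know a X))))"
    using assms by (intro KB4NE_conseq0) auto
  from Know_mono[OF a this] KB4NE.Ax4[OF assms]
  have "KB4NE A APe (KImp (KNeg (Know a (KNeg (KNeg (Know a X))))) (KNeg (Know a X)))"
    by (rule KB4NE_conseq2) (use assms in auto)
  from Know_mono[OF a this] KB4NE.AxB[OF a, of APe "KNeg (Know a X)"]
  show ?thesis
    by (rule KB4NE_conseq2) (use assms in auto)
qed

text \<open>Axiom T relative to aliveness. If \<open>X\<close> were known but false, 4 would give
  knowledge of \<open>Know a X\<close> and B, up to double negation, knowledge of its negation, so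
  falsity would be known.\<close>

lemma Alive_imp_Know_truth:
  assumes a: "a \<in> A" and \<chi>: "kb4_formula A APe \<chi>" and X: "kb4_formula A APe X"
  shows "KB4NE A APe (KImp (Alive \<chi> a) (KImp (Know a X) X))"
proof -
  have "KB4NE A APe (KImp X (KNeg (KNeg X)))"
    using X by (intro KB4NE_conseq0) auto
  from Know_mono[OF a this]
  have "KB4NE A APe (KImp (KNeg (Know a (KNeg (KNeg X)))) (KImp (Know a X) (KBot \<chi>)))"
    by (rule KB4NE_conseq1) (use assms in auto)
  from Know_mono2[OF a this] KB4NE.AxB[OF a, of APe "KNeg X"] KB4NE.Ax4[OF a X]
  show ?thesis
    by (rule KB4NE_conseq3) (use assms in auto)
qed

section \<open>Interpreting 2CH in KB4 + NE\<close>

text \<open>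
  The value at agent atoms is irrelevant, since translated formulas contain none; it only has to be
  local and to imply aliveness.
\<close>

fun agent_to_kb4 ::
    "('ag, 'pe) kform \<Rightarrow> 'ag \<Rightarrow> ('ag, 'pa, 'pe) aform \<Rightarrow> ('ag, 'pe) kform"
  and world_to_kb4 :: "('ag, 'pe) kform \<Rightarrow> ('ag, 'pa, 'pe) wform \<Rightarrow> ('ag, 'pe) kform" where
  "agent_to_kb4 \<chi> a (AAtom b p) = KBot \<chi>"
| "agent_to_kb4 \<chi> a (ANeg \<phi>) = KAnd (Alive \<chi> a) (KNeg (agent_to_kb4 \<chi> a \<phi>))"
| "agent_to_kb4 \<chi> a (AAnd \<phi> \<psi>) = KAnd (agent_to_kb4 \<chi> a \<phi>) (agent_to_kb4 \<chi> a \<psi>)"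
| "agent_to_kb4 \<chi> a (Dia b \<Phi>) = KNeg (Know b (KNeg (world_to_kb4 \<chi> \<Phi>)))"
| "world_to_kb4 \<chi> (WAtom p) = KAtom p"
| "world_to_kb4 \<chi> (WNeg \<Phi>) = KNeg (world_to_kb4 \<chi> \<Phi>)"
| "world_to_kb4 \<chi> (WAnd \<Phi> \<Psi>) = KAnd (world_to_kb4 \<chi> \<Phi>) (world_to_kb4 \<chi> \<Psi>)"
| "world_to_kb4 \<chi> (Poss a \<phi>) = agent_to_kb4 \<chi> a \<phi>"

text \<open>Membership of \<open>a\<close> in \<open>A\<close> is carried along because the clause
  for negation inserts \<open>Alive \<chi> a\<close>.\<close>

lemma kb4_formula_to_kb4:
  assumes "kb4_formula A APe \<chi>"
  shows "agent_formula A AP APe a \<phi> \<Longrightarrow> a \<in> A \<and> kb4_formula A APe (agent_to_kb4 \<chi> a \<phi>)"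
    and "world_formula A AP APe \<Phi> \<Longrightarrow> kb4_formula A APe (world_to_kb4 \<chi> \<Phi>)"
  by (induction rule: agent_formula_world_formula.inducts) (use assms in auto)

text \<open>Relative negation agrees with negation only where \<open>a\<close> is alive.\<close>

lemma keval_agent_to_kb4:
  assumes "keval v (Alive \<chi> a)"
  shows "keval v (agent_to_kb4 \<chi> a \<phi>) \<longleftrightarrow> aeval (\<lambda>x. keval v (agent_to_kb4 \<chi> a x)) \<phi>"
  using assms
  by (induction \<phi> rule: aform.induct[where ?P2.0 = "\<lambda>_. True"]) auto

lemma keval_world_to_kb4:
  "keval v (world_to_kb4 \<chi> \<Phi>) \<longleftrightarrow> weval (\<lambda>X. keval v (world_to_kb4 \<chi> X)) \<Phi>"
  by (induction \<Phi> rule: wform.induct[where ?P1.0 = "\<lambda>_. True"]) auto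

lemma world_to_kb4_foldr_WOr:
  "world_to_kb4 \<chi> (foldr WOr Xs Y) = foldr KOr (map (world_to_kb4 \<chi>) Xs) (world_to_kb4 \<chi> Y)"
  by (induction Xs) auto

section \<open>Aliveness and locality of interpreted agent formulas\<close>

text \<open>A dead agent knows everything, which refutes the value of \<open>Dia\<close>. The
  induction stops at \<open>Dia\<close>, so the predicate on world formulas is trivial.\<close>

lemma agent_to_kb4_imp_Alive:
  assumes \<chi>: "kb4_formula A APe \<chi>" and "agent_formula A AP APe a \<phi>"
  shows "KB4NE A APe (KImp (agent_to_kb4 \<chi> a \<phi>) (Alive \<chi> a))"
  using assms(2)
proof (induction \<phi> rule: aform.induct[where ?P2.0 = "\<lambda>_. True"])
  case (AAtom b p)
  then show ?case using \<chi> by (intro KB4NE_conseq0) auto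
next
  case (ANeg \<phi>)
  then show ?case using \<chi> kb4_formula_to_kb4[OF \<chi>] by (intro KB4NE_conseq0) auto
next
  case (AAnd \<phi> \<psi>)
  then have "KB4NE A APe (KImp (agent_to_kb4 \<chi> a \<phi>) (Alive \<chi> a))"
    by simp
  then show ?case
    by (rule KB4NE_conseq1) (use AAnd.prems \<chi> kb4_formula_to_kb4[OF \<chi>] in auto)
next
  case (Dia b \<Phi>)
  then have a: "b = a" "a \<in> A" and \<Phi>: "kb4_formula A APe (world_to_kb4 \<chi> \<Phi>)"
    using kb4_formula_to_kb4[OF \<chi>] by auto
  have "KB4NE A APe (KImp (KNeg (Alive \<chi> a)) (Know a (KNeg (world_to_kb4 \<chi> \<Phi>))))"
    using a \<chi> \<Phi> by (intro not_Alive_imp_Know) auto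
  then show ?case
    by (rule KB4NE_conseq1) (use a \<chi> \<Phi> in auto)
qed auto

text \<open>Both halves are proved together since negation exchanges them. For \<open>Dia\<close>
  they are negative introspection and axiom 4.\<close>

lemma agent_to_kb4_local:
  assumes \<chi>: "kb4_formula A APe \<chi>" and "agent_formula A AP APe a \<phi>"
  shows "KB4NE A APe (KImp (agent_to_kb4 \<chi> a \<phi>) (Know a (agent_to_kb4 \<chi> a \<phi>)))
    \<and> KB4NE A APe (KImp (KNeg (agent_to_kb4 \<chi> a \<phi>)) (Know a (KNeg (agent_to_kb4 \<chi> a \<phi>))))"
  using assms(2)
proof (induction \<phi> rule: aform.induct[where ?P2.0 = "\<lambda>_. True"])
  case (AAtom b p)
  then have a: "a \<in> A" by simp
  have "KB4NE A APe (KNeg (KBot \<chi>))"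
    using \<chi> by (intro KB4NE_conseq0) auto
  from KB4NE_conseq1[OF KB4NE.Nec[OF a this]] show ?case
    using a \<chi> by auto
next
  case (ANeg \<phi>)
  let ?X = "agent_to_kb4 \<chi> a \<phi>" and ?L = "Alive \<chi> a"
  have wf: "a \<in> A" "kb4_formula A APe ?X"
    using ANeg.prems kb4_formula_to_kb4[OF \<chi>] by auto
  have IH: "KB4NE A APe (KImp ?X (Know a ?X))"
      "KB4NE A APe (KImp (KNeg ?X) (Know a (KNeg ?X)))"
    using ANeg by auto
  have "KB4NE A APe (KImp ?L (KImp (KNeg ?X) (KAnd ?L (KNeg ?X))))"
    using wf \<chi> by (intro KB4NE_conseq0) auto
  from Know_mono2[OF wf(1) this] Know_Alive[OF wf(1) \<chi>] IH(2)
  have 1: "KB4NE A APe (KImp (KAnd ?L (KNeg ?X)) (Know a (KAnd ?L (KNeg ?X))))"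
    by (rule KB4NE_conseq3) (use wf \<chi> in auto)
  \<comment> \<open>The relative negation fails either because \<open>?X\<close> holds, which is
    known by locality, or because \<open>a\<close> is dead and knows everything.\<close>
  have "KB4NE A APe (KImp ?X (KNeg (KAnd ?L (KNeg ?X))))"
    using wf \<chi> by (intro KB4NE_conseq0) auto
  from Know_mono[OF wf(1) this] IH(1)
    not_Alive_imp_Know[OF wf(1) \<chi>, of "KNeg (KAnd ?L (KNeg ?X))"]
  have "KB4NE A APe (KImp (KNeg (KAnd ?L (KNeg ?X))) (Know a (KNeg (KAnd ?L (KNeg ?X)))))"
    by (rule KB4NE_conseq3) (use wf \<chi> in auto)
  with 1 show ?case by simp
next
  case (AAnd \<phi> \<psi>)
  let ?X = "agent_to_kb4 \<chi> a \<phi>" and ?Y = "agent_to_kb4 \<chi> a \<psi>"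
  have wf: "a \<in> A" "kb4_formula A APe ?X" "kb4_formula A APe ?Y"
    using AAnd.prems kb4_formula_to_kb4[OF \<chi>] by auto
  have IH: "KB4NE A APe (KImp ?X (Know a ?X))"
      "KB4NE A APe (KImp (KNeg ?X) (Know a (KNeg ?X)))"
      "KB4NE A APe (KImp ?Y (Know a ?Y))"
      "KB4NE A APe (KImp (KNeg ?Y) (Know a (KNeg ?Y)))"
    using AAnd by auto
  have "KB4NE A APe (KImp ?X (KImp ?Y (KAnd ?X ?Y)))"
    using wf by (intro KB4NE_conseq0) auto
  from Know_mono2[OF wf(1) this] IH(1,3)
  have 1: "KB4NE A APe (KImp (KAnd ?X ?Y) (Know a (KAnd ?X ?Y)))"
    by (rule KB4NE_conseq3) (use wf in auto)
  have "KB4NE A APe (KImp (KNeg ?X) (KNeg (KAnd ?X ?Y)))"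
    using wf by (intro KB4NE_conseq0) auto
  from Know_mono[OF wf(1) this] IH(2)
  have 2: "KB4NE A APe (KImp (KNeg ?X) (Know a (KNeg (KAnd ?X ?Y))))"
    by (rule KB4NE_conseq2) (use wf in auto)
  have "KB4NE A APe (KImp (KNeg ?Y) (KNeg (KAnd ?X ?Y)))"
    using wf by (intro KB4NE_conseq0) auto
  from Know_mono[OF wf(1) this] IH(4) 2
  have "KB4NE A APe (KImp (KNeg (KAnd ?X ?Y)) (Know a (KNeg (KAnd ?X ?Y))))"
    by (rule KB4NE_conseq3) (use wf in auto)
  with 1 show ?case by simp
next
  case (Dia b \<Phi>)
  let ?N = "KNeg (world_to_kb4 \<chi> \<Phi>)"
  have wf: "b = a" "a \<in> A" "kb4_formula A APe ?N"
    using Dia.prems kb4_formula_to_kb4[OF \<chi>] by auto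
  have "KB4NE A APe (KImp (Know a ?N) (KNeg (KNeg (Know a ?N))))"
    using wf by (intro KB4NE_conseq0) auto
  from Know_mono[OF wf(2) this] KB4NE.Ax4[OF wf(2,3)]
  have "KB4NE A APe (KImp (KNeg (KNeg (Know a ?N))) (Know a (KNeg (KNeg (Know a ?N)))))"
    by (rule KB4NE_conseq2) (use wf in auto)
  with Know_negative_introspection[OF wf(2,3)] wf(1) show ?case
    by simp
qed auto

text \<open>Truth at sort \<open>a\<close> is interpreted as aliveness, hence the relative form of
  the claim for agent formulas.\<close>

lemma derivable_imp_KB4NE:
  assumes \<chi>: "kb4_formula A APe \<chi>"
  shows "agent_derivable A AP APe a \<phi> \<Longrightarrow>
      KB4NE A APe (KImp (Alive \<chi> a) (agent_to_kb4 \<chi> a \<phi>))"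
    and "world_derivable A AP APe \<Phi> \<Longrightarrow> KB4NE A APe (world_to_kb4 \<chi> \<Phi>)"
proof (induction rule: agent_derivable_world_derivable.inducts)
  case (ATaut a \<phi>)
  then have "a \<in> A" "kb4_formula A APe (agent_to_kb4 \<chi> a \<phi>)"
    using kb4_formula_to_kb4[OF \<chi>] by auto
  moreover have "keval v (agent_to_kb4 \<chi> a \<phi>)" if "keval v (Alive \<chi> a)" for v
    using ATaut(2) by (subst keval_agent_to_kb4[OF that]) (simp add: atautology_def)
  ultimately show ?case
    using \<chi> by (intro KB4NE_conseq0) auto
next
  case (WTaut \<Phi>)
  then show ?case
    using kb4_formula_to_kb4(2)[OF \<chi>]
    by (intro KB4NE_conseq0) (auto simp: wtautology_def, subst keval_world_to_kb4, simp)
next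
  case (AMP a \<phi> \<psi>)
  show ?case
    by (rule KB4NE_conseq2[OF AMP.IH(2,4)])
      (use KB4NE_formula[OF AMP.IH(2)] in auto)
next
  case (WMP \<Phi> \<Psi>)
  then show ?case by (auto intro: KB4NE.MP)
next
  case (NecBox a \<Phi>)
  let ?X = "world_to_kb4 \<chi> \<Phi>"
  have X: "kb4_formula A APe ?X"
    using KB4NE_formula[OF NecBox.IH(3)] by simp
  have "KB4NE A APe (KNeg (KNeg ?X))"
    by (rule KB4NE_conseq1[OF NecBox.IH(3)]) (use X in auto)
  from KB4NE.Nec[OF \<open>a \<in> A\<close> this] show ?case
    by (rule KB4NE_conseq1) (use X \<chi> \<open>a \<in> A\<close> in auto)
next
  case (NecCert a \<phi>)
  show ?case
    by (rule KB4NE_conseq1[OF NecCert.IH(3)]) (use KB4NE_formula[OF NecCert.IH(3)] in auto)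
next
  case (MonoDia a \<Phi> \<Psi>)
  let ?X = "world_to_kb4 \<chi> \<Phi>" and ?Y = "world_to_kb4 \<chi> \<Psi>"
  have wf: "kb4_formula A APe ?X" "kb4_formula A APe ?Y"
    using KB4NE_formula[OF MonoDia.IH(3)] by auto
  have "KB4NE A APe (KImp (KNeg ?Y) (KNeg ?X))"
    by (rule KB4NE_conseq1[OF MonoDia.IH(3)]) (use wf in auto)
  from Know_mono[OF \<open>a \<in> A\<close> this] show ?case
    by (rule KB4NE_conseq1) (use wf \<chi> \<open>a \<in> A\<close> in auto)
next
  case (MonoBox a \<Phi> \<Psi>)
  let ?X = "world_to_kb4 \<chi> \<Phi>" and ?Y = "world_to_kb4 \<chi> \<Psi>"
  have wf: "kb4_formula A APe ?X" "kb4_formula A APe ?Y"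
    using KB4NE_formula[OF MonoBox.IH(3)] by auto
  have "KB4NE A APe (KImp (KNeg (KNeg ?X)) (KNeg (KNeg ?Y)))"
    by (rule KB4NE_conseq1[OF MonoBox.IH(3)]) (use wf in auto)
  from Know_mono[OF \<open>a \<in> A\<close> this] show ?case
    by (rule KB4NE_conseq1) (use wf \<chi> \<open>a \<in> A\<close> in auto)
next
  case (MonoPoss a \<phi> \<psi>)
  have "agent_formula A AP APe a \<phi>"
    using derivable_formula(1)[OF MonoPoss.IH(2)] by auto
  \<comment> \<open>The implication must also hold where \<open>a\<close> is dead; there its left
    side is false.\<close>
  from MonoPoss.IH(3) agent_to_kb4_imp_Alive[OF \<chi> this] show ?case
    by (rule KB4NE_conseq2) (use KB4NE_formula[OF MonoPoss.IH(3)] in auto)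
next
  case (MonoCert a \<phi> \<psi>)
  show ?case
    by (rule KB4NE_conseq1[OF MonoCert.IH(3)]) (use KB4NE_formula[OF MonoCert.IH(3)] in auto)
next
  case (AdjDiaCert1 a \<Phi> \<psi>)
  let ?X = "world_to_kb4 \<chi> \<Phi>" and ?Y = "agent_to_kb4 \<chi> a \<psi>" and ?L = "Alive \<chi> a"
  have wf: "a \<in> A" "kb4_formula A APe ?X" "kb4_formula A APe ?Y"
    using KB4NE_formula[OF AdjDiaCert1.IH(3)] AdjDiaCert1.IH(1) by auto
  have \<psi>: "agent_formula A AP APe a \<psi>"
    using derivable_formula(2)[OF AdjDiaCert1.IH(2)] by auto
  \<comment> \<open>Boxing this, with \<open>?L\<close> always known and \<open>KNeg ?Y\<close>
    local, shows that \<open>KNeg ?Y\<close> implies knowledge of \<open>KNeg ?X\<close>; the goal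
    is the contrapositive.\<close>
  have "KB4NE A APe (KImp ?L (KImp (KNeg ?Y) (KNeg ?X)))"
    by (rule KB4NE_conseq1[OF AdjDiaCert1.IH(3)]) (use wf \<chi> in auto)
  from Know_mono2[OF wf(1) this] Know_Alive[OF wf(1) \<chi>] conjunct2[OF agent_to_kb4_local[OF \<chi> \<psi>]]
  show ?case
    by (rule KB4NE_conseq3) (use wf \<chi> in auto)
next
  case (AdjDiaCert2 a \<Phi> \<psi>)
  let ?X = "world_to_kb4 \<chi> \<Phi>" and ?Y = "agent_to_kb4 \<chi> a \<psi>"
  have wf: "a \<in> A" "kb4_formula A APe ?X" "kb4_formula A APe ?Y"
    using KB4NE_formula[OF AdjDiaCert2.IH(3)] AdjDiaCert2.IH(1) by auto
  from AdjDiaCert2.IH(3) Alive_imp_Know_truth[OF wf(1) \<chi>, of "KNeg ?X"]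
  show ?case
    by (rule KB4NE_conseq2) (use wf \<chi> in auto)
next
  case (AdjPossBox1 a \<phi> \<Psi>)
  let ?X = "agent_to_kb4 \<chi> a \<phi>" and ?Y = "world_to_kb4 \<chi> \<Psi>"
  have wf: "a \<in> A" "kb4_formula A APe ?X" "kb4_formula A APe ?Y"
    using KB4NE_formula[OF AdjPossBox1.IH(3)] AdjPossBox1.IH(1) by auto
  have \<phi>: "agent_formula A AP APe a \<phi>"
    using derivable_formula(1)[OF AdjPossBox1.IH(2)] by auto
  from AdjPossBox1.IH(3) Alive_imp_Know_truth[OF wf(1) \<chi>, of "KNeg (KNeg ?Y)"]
    agent_to_kb4_imp_Alive[OF \<chi> \<phi>]
  show ?case
    by (rule KB4NE_conseq3) (use wf \<chi> in auto)
next
  case (AdjPossBox2 a \<phi> \<Psi>)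
  let ?X = "agent_to_kb4 \<chi> a \<phi>" and ?Y = "world_to_kb4 \<chi> \<Psi>"
  have wf: "a \<in> A" "kb4_formula A APe ?X" "kb4_formula A APe ?Y"
    using KB4NE_formula[OF AdjPossBox2.IH(3)] AdjPossBox2.IH(1) by auto
  have \<phi>: "agent_formula A AP APe a \<phi>"
    using derivable_formula(2)[OF AdjPossBox2.IH(2)] by auto
  \<comment> \<open>Under \<open>Know a\<close>, the left side may be replaced by \<open>?X\<close>
    because \<open>?X\<close> is local.\<close>
  have "KB4NE A APe (KImp ?X (KNeg (KNeg ?Y)))"
    by (rule KB4NE_conseq1[OF AdjPossBox2.IH(3)]) (use wf \<chi> in auto)
  from Know_mono[OF wf(1) this] conjunct1[OF agent_to_kb4_local[OF \<chi> \<phi>]]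
  show ?case
    by (rule KB4NE_conseq2) (use wf \<chi> in auto)
next
  case (AxDiaPoss1 a \<phi>)
  let ?X = "agent_to_kb4 \<chi> a \<phi>"
  have wf: "a \<in> A" "kb4_formula A APe ?X"
    using AxDiaPoss1 kb4_formula_to_kb4[OF \<chi>] by auto
  from Alive_imp_Know_truth[OF wf(1) \<chi>, of "KNeg ?X"] show ?case
    by (rule KB4NE_conseq1) (use wf \<chi> in auto)
next
  case (AxDiaPoss2 a \<phi>)
  let ?X = "agent_to_kb4 \<chi> a \<phi>"
  have wf: "a \<in> A" "kb4_formula A APe ?X"
    using AxDiaPoss2 kb4_formula_to_kb4[OF \<chi>] by auto
  from conjunct2[OF agent_to_kb4_local[OF \<chi> AxDiaPoss2(2)]] show ?case
    by (rule KB4NE_conseq1) (use wf \<chi> in auto)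
next
  case (AxNE2 as \<xi> \<zeta>)
  \<comment> \<open>Each \<open>Poss a (ATop (\<xi> a))\<close> is interpreted by a propositional
    equivalent of \<open>Alive \<chi> a\<close>, so this is axiom NE.\<close>
  show ?case
    unfolding world_to_kb4_foldr_WOr
    by (rule KB4NE_conseq1[OF KB4NE.AxNE[OF AxNE2(1,2) \<chi>]])
      (use AxNE2 \<chi> kb4_formula_to_kb4[OF \<chi>] in \<open>auto simp: kb4_formula_foldr_KOr keval_foldr_KOr\<close>)
qed

section \<open>The interpretation inverts the translation\<close>

lemma world_to_kb4_kb4_to_2ch:
  assumes \<chi>: "kb4_formula A APe \<chi>" and "kb4_formula A APe \<Phi>"
  defines "s \<equiv> \<lambda>X. world_to_kb4 \<chi> (kb4_to_2ch X :: ('ag, 'pa, 'pe) wform)"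
  shows "KB4NE A APe (KImp (s \<Phi>) \<Phi>) \<and> KB4NE A APe (KImp \<Phi> (s \<Phi>))"
  using assms(2)
proof (induction \<Phi> rule: kform.induct)
  case (KAtom p)
  then show ?case by (auto simp: s_def intro!: KB4NE_conseq0)
next
  case (KNeg \<Phi>)
  then have IH: "KB4NE A APe (KImp (s \<Phi>) \<Phi>)" "KB4NE A APe (KImp \<Phi> (s \<Phi>))"
    by auto
  have s: "s (KNeg \<Phi>) = KNeg (s \<Phi>)"
    by (simp add: s_def)
  show ?case
    unfolding s using KB4NE_formula[OF IH(1)]
    by (intro conjI KB4NE_conseq2[OF IH]) auto
next
  case (KAnd \<Phi> \<Psi>)
  then have IH: "KB4NE A APe (KImp (s \<Phi>) \<Phi>)" "KB4NE A APe (KImp \<Phi> (s \<Phi>))"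
      "KB4NE A APe (KImp (s \<Psi>) \<Psi>)" "KB4NE A APe (KImp \<Psi> (s \<Psi>))"
    by auto
  have s: "s (KAnd \<Phi> \<Psi>) = KAnd (s \<Phi>) (s \<Psi>)"
    by (simp add: s_def)
  show ?case
    unfolding s using KB4NE_formula[OF IH(1)] KB4NE_formula[OF IH(3)]
    by (intro conjI KB4NE_conseq2[OF IH(1,3)] KB4NE_conseq2[OF IH(2,4)]) auto
next
  case (Know a \<Phi>)
  then have IH: "KB4NE A APe (KImp (s \<Phi>) \<Phi>)" "KB4NE A APe (KImp \<Phi> (s \<Phi>))" and a: "a \<in> A"
    by auto
  have wf: "kb4_formula A APe \<Phi>" "kb4_formula A APe (s \<Phi>)"
    using KB4NE_formula[OF IH(1)] by auto
  let ?K = "Know a (KNeg (KNeg (s \<Phi>)))"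
  \<comment> \<open>Propositionally this says that \<open>Alive \<chi> a\<close> implies
    \<open>?K\<close>. The guard is harmless, since a dead agent knows \<open>\<Phi>\<close>
    anyway.\<close>
  have s: "s (Know a \<Phi>) = KNeg (KAnd (Alive \<chi> a) (KNeg (KAnd (Alive \<chi> a) (KNeg (KNeg ?K)))))"
    by (simp add: s_def)
  have "KB4NE A APe (KImp (KNeg (KNeg (s \<Phi>))) \<Phi>)" "KB4NE A APe (KImp \<Phi> (KNeg (KNeg (s \<Phi>))))"
    by (rule KB4NE_conseq1[OF IH(1)], use wf in auto)
      (rule KB4NE_conseq1[OF IH(2)], use wf in auto)
  note K = this[THEN Know_mono[OF a]]
  show ?case
    unfolding s using a wf \<chi>
    by (intro conjI KB4NE_conseq2[OF K(1) not_Alive_imp_Know[OF a \<chi> wf(1)]] KB4NE_conseq1[OF K(2)])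
      auto
qed

theorem mainTheorem2:
  fixes A :: "'ag set" and AP :: "'ag \<Rightarrow> 'pa set" and APe :: "'pe set"
    and \<Phi> :: "('ag, 'pe) kform"
  assumes "finite A"
    and "kb4_formula A APe \<Phi>"
  shows "KB4NE A APe \<Phi> \<longleftrightarrow> world_derivable A AP APe (kb4_to_2ch \<Phi>)"
proof
  assume "KB4NE A APe \<Phi>"
  then show "world_derivable A AP APe (kb4_to_2ch \<Phi>)"
    by (rule KB4NE_imp_world_derivable)
next
  assume "world_derivable A AP APe (kb4_to_2ch \<Phi>)"
  \<comment> \<open>\<open>\<Phi>\<close> itself is the well-formed formula from which falsity is
    written.\<close>
  then have "KB4NE A APe (world_to_kb4 \<Phi> (kb4_to_2ch \<Phi> :: ('ag, 'pa, 'pe) wform))"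
    by (rule derivable_imp_KB4NE(2)[OF assms(2)])
  with world_to_kb4_kb4_to_2ch[OF assms(2,2)] show "KB4NE A APe \<Phi>"
    using KB4NE.MP by blast
qed

end
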